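(* Let $(M,J,g)$ be a $\mathcal{W}_3$-manifold (quasi-Kähler manifold with Norden metric), and let $\nabla'$ be the linear connection $\nabla'_x y=\nabla_x y+Q(x,y)$, where $Q(x,y)=\frac14\{(\nabla_xJ)Jy-(\nabla_{Jx}J)y-2(\nabla_yJ)Jx\}$. Let $R$ and $R'$ be the curvature tensors of type $(0,4)$ of $\nabla$ and $\nabla'$. Then $R'$ is a Kähler tensor if and only if $$3R'(x,y,z,w)=3R(x,y,z,w)+2g\bigl(Q(x,y),Q(z,w)\bigr)+g\bigl(Q(z,y),Q(x,w)\bigr)+g\bigl(Q(x,z),Q(y,w)\bigr)$$ for all smooth vector fields $x,y,z,w$ on $M$.
   Context: An almost complex manifold with Norden metric $(M,J,g)$ is a $2n$-dimensional differentiable manifold $M$ with an almost complex structure $J$ and a pseudo-Riemannian metric $g$ such that $J^2x=-x$ and $g(Jx,Jy)=-g(x,y)$ for all smooth vector fields $x,y$ (so $g$ has signature $(n,n)$). $\nabla$ is the Levi-Civita connection of $g$, and $F(x,y,z)=g((\nabla_xJ)y,z)$. $(M,J,g)$ is a $\mathcal{W}_3$-manifold if the cyclic sum $F(x,y,z)+F(y,z,x)+F(z,x,y)$ vanishes for all $x,y,z$. The curvature tensor of $\nabla$ is $R(x,y)z=\nabla_x\nabla_yz-\nabla_y\nabla_xz-\nabla_{[x,y]}z$, with $R(x,y,z,w)=g(R(x,y)z,w)$; $R'$ is defined in the same way from $\nabla'$. A tensor $L$ of type $(0,4)$ is curvature-like if $L(x,y,z,w)=-L(y,x,z,w)=-L(x,y,w,z)$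 and $L(x,y,z,w)+L(y,z,x,w)+L(z,x,y,w)=0$. A curvature-like tensor $L$ is a Kähler tensor (is Kählerian) if in addition $L(x,y,Jz,Jw)=-L(x,y,z,w)$. *)

theory Defs
  imports "HOL-Analysis.Analysis" "HOL-Library.Function_Algebras"
begin

section \<open>Smooth manifolds\<close>

text \<open>The set \<open>S\<close> is always open below. By induction on \<open>k\<close>, the derivative condition says that all
  iterated directional derivatives up to order \<open>k\<close> exist and are continuous, i.e. class \<open>C^k\<close>.\<close>

primrec Ck_on :: "nat \<Rightarrow> 'e::euclidean_space set \<Rightarrow> ('e \<Rightarrow> 'f::real_normed_vector) \<Rightarrow> bool" where
  "Ck_on 0 S f \<longleftrightarrow> continuous_on S f"
| "Ck_on (Suc k) S f \<longleftrightarrow> (\<forall>x\<in>S. f differentiable (at x)) \<and>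
     (\<forall>v. Ck_on k S (\<lambda>x. frechet_derivative f (at x) v))"

definition smooth_on :: "'e::euclidean_space set \<Rightarrow> ('e \<Rightarrow> 'f::real_normed_vector) \<Rightarrow> bool" where
  "smooth_on S f \<longleftrightarrow> (\<forall>k. Ck_on k S f)"

text \<open>A chart is a pair of its domain and its coordinate map; only the values of the map on the
  domain matter. The manifold is the whole type \<open>'m\<close>, its dimension is \<open>DIM('e)\<close>; the atlas need
  not be maximal.\<close>

type_synonym ('m, 'e) chart = "'m set \<times> ('m \<Rightarrow> 'e)"

definition is_chart :: "('m::topological_space, 'e::euclidean_space) chart \<Rightarrow> bool" where
  "is_chart = (\<lambda>(U, \<phi>). open U \<and> open (\<phi> ` U) \<and> inj_on \<phi> U \<and>
     continuous_on U \<phi> \<and> continuous_on (\<phi> ` U) (inv_into U \<phi>))"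

definition smooth_manifold ::
  "('m::{t2_space,second_countable_topology}, 'e::euclidean_space) chart set \<Rightarrow> bool" where
  "smooth_manifold A \<longleftrightarrow>
     (\<forall>c\<in>A. is_chart c) \<and> (\<Union>c\<in>A. fst c) = UNIV \<and>
     (\<forall>(U, \<phi>)\<in>A. \<forall>(V, \<psi>)\<in>A. smooth_on (\<phi> ` (U \<inter> V)) (\<psi> \<circ> inv_into U \<phi>))"

definition smooth_functions ::
  "('m::topological_space, 'e::euclidean_space) chart set \<Rightarrow> ('m \<Rightarrow> real) set" where
  "smooth_functions A = {f. \<forall>(U, \<phi>)\<in>A. smooth_on (\<phi> ` U) (f \<circ> inv_into U \<phi>)}"


section \<open>Tangent vectors and vector fields\<close>

text \<open>Tangent vectors at \<open>p\<close> are the derivations at \<open>p\<close> of the algebra of smooth functions. As HOL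
  functions are total, they are normalised to vanish on non-smooth functions, so that equality of
  tangent vectors is equality in HOL. The vector space operations are the pointwise ones.\<close>

type_synonym 'm tvec = "('m \<Rightarrow> real) \<Rightarrow> real"
type_synonym 'm vfield = "'m \<Rightarrow> 'm tvec"

definition tangent_space ::
  "('m::topological_space, 'e::euclidean_space) chart set \<Rightarrow> 'm \<Rightarrow> 'm tvec set" where
  "tangent_space A p = {v.
     (\<forall>f\<in>smooth_functions A. \<forall>h\<in>smooth_functions A. v (f + h) = v f + v h) \<and>
     (\<forall>c. \<forall>f\<in>smooth_functions A. v (\<lambda>q. c * f q) = c * v f) \<and>
     (\<forall>f\<in>smooth_functions A. \<forall>h\<in>smooth_functions A. v (f * h) = f p * v h + h p * v f) \<and>
     (\<forall>f. f \<notin> smooth_functions A \<longrightarrow> v f = 0)}"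

definition vector_fields ::
  "('m::topological_space, 'e::euclidean_space) chart set \<Rightarrow> 'm vfield set" where
  "vector_fields A = {X. (\<forall>p. X p \<in> tangent_space A p) \<and>
     (\<forall>f\<in>smooth_functions A. (\<lambda>p. X p f) \<in> smooth_functions A)}"

definition tscale :: "real \<Rightarrow> 'm tvec \<Rightarrow> 'm tvec" where
  "tscale c v = (\<lambda>f. c * v f)"

definition fscale :: "('m \<Rightarrow> real) \<Rightarrow> 'm vfield \<Rightarrow> 'm vfield" where
  "fscale f X = (\<lambda>p. tscale (f p) (X p))"

definition vscale :: "real \<Rightarrow> 'm vfield \<Rightarrow> 'm vfield" where
  "vscale c X = fscale (\<lambda>_. c) X"

definition dir_deriv :: "'m vfield \<Rightarrow> ('m \<Rightarrow> real) \<Rightarrow> 'm \<Rightarrow> real" where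
  "dir_deriv X f = (\<lambda>p. X p f)"

definition lie_bracket :: "'m vfield \<Rightarrow> 'm vfield \<Rightarrow> 'm vfield" where
  "lie_bracket X Y = (\<lambda>p f. X p (dir_deriv Y f) - Y p (dir_deriv X f))"


section \<open>Tensor fields\<close>

type_synonym 'm endo_field = "'m \<Rightarrow> 'm tvec \<Rightarrow> 'm tvec"
type_synonym 'm bilin_field = "'m \<Rightarrow> 'm tvec \<Rightarrow> 'm tvec \<Rightarrow> real"

definition app1 :: "'m endo_field \<Rightarrow> 'm vfield \<Rightarrow> 'm vfield" where
  "app1 J X = (\<lambda>p. J p (X p))"

definition app2 :: "'m bilin_field \<Rightarrow> 'm vfield \<Rightarrow> 'm vfield \<Rightarrow> 'm \<Rightarrow> real" where
  "app2 g X Y = (\<lambda>p. g p (X p) (Y p))"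

definition tensor11 ::
  "('m::topological_space, 'e::euclidean_space) chart set \<Rightarrow> 'm endo_field \<Rightarrow> bool" where
  "tensor11 A J \<longleftrightarrow>
     (\<forall>p. \<forall>v\<in>tangent_space A p. J p v \<in> tangent_space A p) \<and>
     (\<forall>p. \<forall>v\<in>tangent_space A p. \<forall>w\<in>tangent_space A p. J p (v + w) = J p v + J p w) \<and>
     (\<forall>p c. \<forall>v\<in>tangent_space A p. J p (tscale c v) = tscale c (J p v)) \<and>
     (\<forall>X\<in>vector_fields A. app1 J X \<in> vector_fields A)"

definition pseudo_riemannian_metric ::
  "('m::topological_space, 'e::euclidean_space) chart set \<Rightarrow> 'm bilin_field \<Rightarrow> bool" where
  "pseudo_riemannian_metric A g \<longleftrightarrow>
     (\<forall>p. \<forall>u\<in>tangent_space A p. \<forall>v\<in>tangent_space A p. \<forall>w\<in>tangent_space A p.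
        g p (u + v) w = g p u w + g p v w) \<and>
     (\<forall>p c. \<forall>v\<in>tangent_space A p. \<forall>w\<in>tangent_space A p. g p (tscale c v) w = c * g p v w) \<and>
     (\<forall>p. \<forall>v\<in>tangent_space A p. \<forall>w\<in>tangent_space A p. g p v w = g p w v) \<and>
     (\<forall>p. \<forall>v\<in>tangent_space A p. (\<forall>w\<in>tangent_space A p. g p v w = 0) \<longrightarrow> v = 0) \<and>
     (\<forall>X\<in>vector_fields A. \<forall>Y\<in>vector_fields A. app2 g X Y \<in> smooth_functions A)"

definition almost_complex_norden ::
  "('m::topological_space, 'e::euclidean_space) chart set \<Rightarrow> 'm endo_field \<Rightarrow> 'm bilin_field \<Rightarrow> bool"
  where
  "almost_complex_norden A J g \<longleftrightarrow>
     tensor11 A J \<and> pseudo_riemannian_metric A g \<and>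
     (\<forall>x\<in>vector_fields A. app1 J (app1 J x) = - x) \<and>
     (\<forall>x\<in>vector_fields A. \<forall>y\<in>vector_fields A. app2 g (app1 J x) (app1 J y) = - app2 g x y)"

text \<open>Covariant tensor fields given by their values on vector fields: multilinear over the smooth
  functions, with smooth functions as values.\<close>

definition function_linear ::
  "('m::topological_space, 'e::euclidean_space) chart set \<Rightarrow> ('m vfield \<Rightarrow> 'm \<Rightarrow> real) \<Rightarrow> bool" where
  "function_linear A L \<longleftrightarrow>
     (\<forall>X\<in>vector_fields A. L X \<in> smooth_functions A) \<and>
     (\<forall>X\<in>vector_fields A. \<forall>Y\<in>vector_fields A. L (X + Y) = L X + L Y) \<and>
     (\<forall>f\<in>smooth_functions A. \<forall>X\<in>vector_fields A. L (fscale f X) = f * L X)"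

type_synonym 'm field04 = "'m vfield \<Rightarrow> 'm vfield \<Rightarrow> 'm vfield \<Rightarrow> 'm vfield \<Rightarrow> 'm \<Rightarrow> real"

definition tensor04 ::
  "('m::topological_space, 'e::euclidean_space) chart set \<Rightarrow> 'm field04 \<Rightarrow> bool" where
  "tensor04 A L \<longleftrightarrow>
     (\<forall>x\<in>vector_fields A. \<forall>y\<in>vector_fields A. \<forall>z\<in>vector_fields A.
        function_linear A (\<lambda>u. L u x y z) \<and> function_linear A (\<lambda>u. L x u y z) \<and>
        function_linear A (\<lambda>u. L x y u z) \<and> function_linear A (\<lambda>u. L x y z u))"

definition curvature_like ::
  "('m::topological_space, 'e::euclidean_space) chart set \<Rightarrow> 'm field04 \<Rightarrow> bool" where
  "curvature_like A L \<longleftrightarrow> tensor04 A L \<and>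
     (\<forall>x\<in>vector_fields A. \<forall>y\<in>vector_fields A. \<forall>z\<in>vector_fields A. \<forall>w\<in>vector_fields A.
        L x y z w = - L y x z w \<and> L x y z w = - L x y w z \<and>
        L x y z w + L y z x w + L z x y w = 0)"

definition kaehler_tensor ::
  "('m::topological_space, 'e::euclidean_space) chart set \<Rightarrow> 'm endo_field \<Rightarrow> 'm field04 \<Rightarrow> bool" where
  "kaehler_tensor A J L \<longleftrightarrow> curvature_like A L \<and>
     (\<forall>x\<in>vector_fields A. \<forall>y\<in>vector_fields A. \<forall>z\<in>vector_fields A. \<forall>w\<in>vector_fields A.
        L x y (app1 J z) (app1 J w) = - L x y z w)"


section \<open>Connections and curvature\<close>

type_synonym 'm connection = "'m vfield \<Rightarrow> 'm vfield \<Rightarrow> 'm vfield"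

definition linear_connection ::
  "('m::topological_space, 'e::euclidean_space) chart set \<Rightarrow> 'm connection \<Rightarrow> bool" where
  "linear_connection A D \<longleftrightarrow>
     (\<forall>x\<in>vector_fields A. \<forall>y\<in>vector_fields A. D x y \<in> vector_fields A) \<and>
     (\<forall>x\<in>vector_fields A. \<forall>y\<in>vector_fields A. \<forall>z\<in>vector_fields A.
        D (x + y) z = D x z + D y z \<and> D x (y + z) = D x y + D x z) \<and>
     (\<forall>f\<in>smooth_functions A. \<forall>x\<in>vector_fields A. \<forall>y\<in>vector_fields A.
        D (fscale f x) y = fscale f (D x y) \<and>
        D x (fscale f y) = fscale (dir_deriv x f) y + fscale f (D x y))"

definition levi_civita ::
  "('m::topological_space, 'e::euclidean_space) chart set \<Rightarrow> 'm bilin_field \<Rightarrow> 'm connection \<Rightarrow> bool"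
  where
  "levi_civita A g D \<longleftrightarrow> linear_connection A D \<and>
     (\<forall>x\<in>vector_fields A. \<forall>y\<in>vector_fields A. D x y - D y x = lie_bracket x y) \<and>
     (\<forall>x\<in>vector_fields A. \<forall>y\<in>vector_fields A. \<forall>z\<in>vector_fields A.
        dir_deriv x (app2 g y z) = app2 g (D x y) z + app2 g y (D x z))"

text \<open>\<open>nabla_endo D J x y\<close> is \<open>(D_x J) y\<close>.\<close>

definition nabla_endo :: "'m connection \<Rightarrow> 'm endo_field \<Rightarrow> 'm connection" where
  "nabla_endo D J x y = D x (app1 J y) - app1 J (D x y)"

definition tensor_F ::
  "'m bilin_field \<Rightarrow> 'm connection \<Rightarrow> 'm endo_field \<Rightarrow> 'm vfield \<Rightarrow> 'm vfield \<Rightarrow> 'm vfield \<Rightarrow> 'm \<Rightarrow> real"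
  where
  "tensor_F g D J x y z = app2 g (nabla_endo D J x y) z"

definition W3_manifold ::
  "('m::{t2_space,second_countable_topology}, 'e::euclidean_space) chart set \<Rightarrow> 'm endo_field \<Rightarrow>
     'm bilin_field \<Rightarrow> 'm connection \<Rightarrow> bool" where
  "W3_manifold A J g D \<longleftrightarrow>
     smooth_manifold A \<and> almost_complex_norden A J g \<and> levi_civita A g D \<and>
     (\<forall>x\<in>vector_fields A. \<forall>y\<in>vector_fields A. \<forall>z\<in>vector_fields A.
        tensor_F g D J x y z + tensor_F g D J y z x + tensor_F g D J z x y = 0)"

definition curvature :: "'m connection \<Rightarrow> 'm vfield \<Rightarrow> 'm vfield \<Rightarrow> 'm vfield \<Rightarrow> 'm vfield" where
  "curvature D x y z = D x (D y z) - D y (D x z) - D (lie_bracket x y) z"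

definition curvature04 :: "'m bilin_field \<Rightarrow> 'm connection \<Rightarrow> 'm field04" where
  "curvature04 g D x y z w = app2 g (curvature D x y z) w"

definition Q_tensor :: "'m connection \<Rightarrow> 'm endo_field \<Rightarrow> 'm connection" where
  "Q_tensor D J x y = vscale (1/4)
     (nabla_endo D J x (app1 J y) - nabla_endo D J (app1 J x) y
      - vscale 2 (nabla_endo D J y (app1 J x)))"

definition nabla' :: "'m connection \<Rightarrow> 'm endo_field \<Rightarrow> 'm connection" where
  "nabla' D J x y = D x y + Q_tensor D J x y"

end

theory Submission
  imports Defs
begin

text \<open>
  Write \<open>Q(x,y,z) = g(Q(x,y),z)\<close>. The vanishing of the cyclic sum of \<open>F\<close>, together with
  \<open>F(x,y,z) = F(x,z,y) = F(x,Jy,Jz)\<close>, makes \<open>Q\<close> a 3-form (\<open>Q_skew_first\<close>, \<open>Q_skew_last\<close>) and makes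
  \<open>J\<close> parallel for \<open>\<nabla>' = \<nabla> + Q\<close> (\<open>J_parallel\<close>). Since \<open>Q\<close> is skew in its last two arguments, \<open>\<nabla>'\<close>
  is a metric connection too. Hence \<open>R'\<close> is always a tensor, skew in each of its two pairs of
  arguments, with \<open>R'(x,y,Jz,Jw) = -R'(x,y,z,w)\<close>. Being a Kaehler tensor is therefore the same as
  satisfying the first Bianchi identity, and the claim becomes one about metric connections whose
  torsion is a 3-form.

  Put \<open>B(x,y,z,w) = g(Q(x,y),Q(z,w))\<close>, let \<open>C(x,y,z,w) = (\<nabla>\<^sub>xQ)(y,z,w)\<close>, and let
  \<open>\<sigma>(x,y,z,w) = B(x,y,z,w) + B(y,z,x,w) + B(z,x,y,w)\<close>. Expanding the curvature of \<open>\<nabla> + Q\<close> gives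
  (\<open>curvature04_conn'\<close>)
  \<open>R' = R + C(x,y,z,w) - C(y,x,z,w) - B(y,z,x,w) - B(z,x,y,w)\<close>.
  The formula of the theorem implies the Bianchi identity of \<open>R'\<close>, because the quadratic terms
  cancel in the cyclic sum. Conversely, suppose that \<open>R'\<close> satisfies the Bianchi identity. Its cyclic
  sum over \<open>x,y,z\<close> says that the cyclic sum of \<open>C\<close> is \<open>\<sigma>\<close>. Moreover \<open>R\<close> and \<open>R'\<close> both have the
  symmetry \<open>R(x,y,z,w) = R(z,w,x,y)\<close>, and in their difference this forces \<open>C\<close> to be totally skew.
  So \<open>3 C = \<sigma>\<close>, and substituting this in the expansion gives the formula
  (\<open>bianchi_iff_curvature_formula\<close>).

  Identities between vector fields are stated after pairing them with an arbitrary vector field by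
  \<open>g\<close>, which avoids extending single tangent vectors to fields. In this form \<open>\<nabla>'\<close> can still be
  iterated, because it is metric: \<open>g(\<nabla>'\<^sub>xu,w) = x g(u,w) - g(u,\<nabla>'\<^sub>xw)\<close> depends only on such pairings.
\<close>


section \<open>The algebra of smooth functions\<close>

text \<open>The derivatives of sums and products are known only at the points of \<open>S\<close>, whereas the
  recursion for \<open>Ck_on\<close> passes to derivatives as total functions. This lemma lets them be replaced
  by their formulas.\<close>

lemma Ck_on_cong:
  assumes "open S" "\<And>x. x \<in> S \<Longrightarrow> f x = h x" "Ck_on k S f"
  shows "Ck_on k S h"
  using assms(2,3)
proof (induction k arbitrary: f h)
  case 0
  then show ?case by (metis Ck_on.simps(1) continuous_on_cong)
next
  case (Suc k)
  have "h differentiable (at x)" if "x \<in> S" for x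
    using Suc.prems that assms(1)
    by (metis Ck_on.simps(2) differentiable_def has_derivative_transform_within_open)
  moreover have "Ck_on k S (\<lambda>x. frechet_derivative h (at x) v)" for v
  proof (rule Suc.IH)
    show "Ck_on k S (\<lambda>x. frechet_derivative f (at x) v)"
      using Suc.prems by simp
    show "frechet_derivative f (at x) v = frechet_derivative h (at x) v" if "x \<in> S" for x
      using frechet_derivative_transform_within_open[of f x S h] Suc.prems assms(1) that by simp
  qed
  ultimately show ?case by simp
qed

lemma Ck_on_SucD: "Ck_on (Suc k) S f \<Longrightarrow> Ck_on k S f"
proof (induction k arbitrary: f)
  case 0
  then show ?case
    by (auto intro!: differentiable_imp_continuous_on differentiable_at_imp_differentiable_on)
next
  case (Suc k)
  then show ?case by (metis Ck_on.simps(2))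
qed

lemma Ck_on_add:
  assumes "open S"
  shows "Ck_on k S f \<Longrightarrow> Ck_on k S h \<Longrightarrow> Ck_on k S (\<lambda>x. f x + h x)"
proof (induction k arbitrary: f h)
  case 0
  then show ?case by (simp add: continuous_on_add)
next
  case (Suc k)
  have "Ck_on k S (\<lambda>x. frechet_derivative (\<lambda>x. f x + h x) (at x) v)" for v
  proof (rule Ck_on_cong[OF assms])
    show "Ck_on k S (\<lambda>x. frechet_derivative f (at x) v + frechet_derivative h (at x) v)"
      using Suc by simp
    show "frechet_derivative f (at x) v + frechet_derivative h (at x) v
        = frechet_derivative (\<lambda>x. f x + h x) (at x) v" if "x \<in> S" for x
    proof -
      have "((\<lambda>x. f x + h x) has_derivative
          (\<lambda>v. frechet_derivative f (at x) v + frechet_derivative h (at x) v)) (at x)"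
        using Suc.prems that by (intro has_derivative_add) (simp_all add: frechet_derivative_works)
      from frechet_derivative_at[OF this] show ?thesis by metis
    qed
  qed
  then show ?case using Suc.prems by simp
qed

lemma Ck_on_mult:
  fixes f h :: "'e::euclidean_space \<Rightarrow> real"
  assumes "open S"
  shows "Ck_on k S f \<Longrightarrow> Ck_on k S h \<Longrightarrow> Ck_on k S (\<lambda>x. f x * h x)"
proof (induction k arbitrary: f h)
  case 0
  then show ?case by (simp add: continuous_on_mult)
next
  case (Suc k)
  have "Ck_on k S (\<lambda>x. frechet_derivative (\<lambda>x. f x * h x) (at x) v)" for v
  proof (rule Ck_on_cong[OF assms])
    show "Ck_on k S
        (\<lambda>x. f x * frechet_derivative h (at x) v + frechet_derivative f (at x) v * h x)"
      using Suc Ck_on_SucD[of k S f] Ck_on_SucD[of k S h] by (intro Ck_on_add[OF assms] Suc.IH) auto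
    show "f x * frechet_derivative h (at x) v + frechet_derivative f (at x) v * h x
        = frechet_derivative (\<lambda>x. f x * h x) (at x) v" if "x \<in> S" for x
    proof -
      have "((\<lambda>x. f x * h x) has_derivative
          (\<lambda>v. f x * frechet_derivative h (at x) v + frechet_derivative f (at x) v * h x)) (at x)"
        using Suc.prems that by (intro has_derivative_mult) (simp_all add: frechet_derivative_works)
      from frechet_derivative_at[OF this] show ?thesis by metis
    qed
  qed
  then show ?case using Suc.prems by simp
qed

lemma Ck_on_const: "Ck_on k S (\<lambda>_. c)"
  by (induction k arbitrary: c) (simp_all add: continuous_on_const)

locale smooth_atlas =
  fixes A :: "('m::{t2_space,second_countable_topology}, 'e::euclidean_space) chart set"
  assumes smooth_atlas: "smooth_manifold A"
begin

abbreviation "smooth \<equiv> smooth_functions A"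
abbreviation "fields \<equiv> vector_fields A"

lemma open_chart_image: "(U, \<phi>) \<in> A \<Longrightarrow> open (\<phi> ` U)"
  using smooth_atlas by (auto simp: smooth_manifold_def is_chart_def)

lemma smooth_const [simp]: "(\<lambda>_. c) \<in> smooth"
  by (simp add: smooth_functions_def smooth_on_def comp_def Ck_on_const)

lemma smooth_zero [simp]: "0 \<in> smooth"
  using smooth_const[of 0] by (simp add: zero_fun_def)

lemma smooth_add [simp]: "f \<in> smooth \<Longrightarrow> h \<in> smooth \<Longrightarrow> f + h \<in> smooth"
  by (auto simp: smooth_functions_def smooth_on_def comp_def
      intro!: Ck_on_add[OF open_chart_image])

lemma smooth_mult [simp]: "f \<in> smooth \<Longrightarrow> h \<in> smooth \<Longrightarrow> f * h \<in> smooth"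
  by (auto simp: smooth_functions_def smooth_on_def comp_def
      intro!: Ck_on_mult[OF open_chart_image])

lemma smooth_minus [simp]: "f \<in> smooth \<Longrightarrow> - f \<in> smooth"
  using smooth_mult[OF smooth_const[of "-1"], of f] by (simp add: fun_Compl_def times_fun_def)

lemma smooth_diff [simp]: "f \<in> smooth \<Longrightarrow> h \<in> smooth \<Longrightarrow> f - h \<in> smooth"
  using smooth_add[of f "- h"] by simp


section \<open>The Lie algebra of vector fields\<close>

lemma field_add: "X \<in> fields \<Longrightarrow> f \<in> smooth \<Longrightarrow> h \<in> smooth \<Longrightarrow> X p (f + h) = X p f + X p h"
  by (auto simp: vector_fields_def tangent_space_def)

lemma field_scale: "X \<in> fields \<Longrightarrow> f \<in> smooth \<Longrightarrow> X p (\<lambda>q. c * f q) = c * X p f"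
  by (auto simp: vector_fields_def tangent_space_def)

lemma field_mult: "X \<in> fields \<Longrightarrow> f \<in> smooth \<Longrightarrow> h \<in> smooth \<Longrightarrow> X p (f * h) = f p * X p h + h p * X p f"
  by (auto simp: vector_fields_def tangent_space_def)

lemma field_nonsmooth: "X \<in> fields \<Longrightarrow> f \<notin> smooth \<Longrightarrow> X p f = 0"
  by (auto simp: vector_fields_def tangent_space_def)

lemma field_zero: "X \<in> fields \<Longrightarrow> X p 0 = 0"
  using field_scale[of X 0 p 0] by (simp add: zero_fun_def)

lemma field_diff: "X \<in> fields \<Longrightarrow> f \<in> smooth \<Longrightarrow> h \<in> smooth \<Longrightarrow> X p (f - h) = X p f - X p h"
  using field_add[of X "f - h" h p] by simp

lemma fieldsI:
  assumes "\<And>p f h. f \<in> smooth \<Longrightarrow> h \<in> smooth \<Longrightarrow> X p (f + h) = X p f + X p h"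
    and "\<And>p c f. f \<in> smooth \<Longrightarrow> X p (\<lambda>q. c * f q) = c * X p f"
    and "\<And>p f h. f \<in> smooth \<Longrightarrow> h \<in> smooth \<Longrightarrow> X p (f * h) = f p * X p h + h p * X p f"
    and "\<And>p f. f \<notin> smooth \<Longrightarrow> X p f = 0"
    and "\<And>f. f \<in> smooth \<Longrightarrow> (\<lambda>p. X p f) \<in> smooth"
  shows "X \<in> fields"
  using assms by (auto simp: vector_fields_def tangent_space_def)

text \<open>Since tangent vectors vanish on non-smooth functions, this holds for every \<open>f\<close>, and
  second derivatives need no case distinction on smoothness.\<close>

lemma smooth_dir_deriv [simp]:
  assumes "X \<in> fields" shows "dir_deriv X f \<in> smooth"
proof (cases "f \<in> smooth")
  case True
  then show ?thesis using assms by (simp add: vector_fields_def dir_deriv_def)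
next
  case False
  then have "dir_deriv X f = 0"
    using assms by (simp add: dir_deriv_def field_nonsmooth fun_eq_iff)
  then show ?thesis by simp
qed

lemma dir_deriv_add:
  "X \<in> fields \<Longrightarrow> f \<in> smooth \<Longrightarrow> h \<in> smooth \<Longrightarrow> dir_deriv X (f + h) = dir_deriv X f + dir_deriv X h"
  by (simp add: dir_deriv_def fun_eq_iff field_add)

lemma dir_deriv_minus:
  "X \<in> fields \<Longrightarrow> f \<in> smooth \<Longrightarrow> dir_deriv X (- f) = - dir_deriv X f"
  using field_diff[of X 0 f] by (simp add: dir_deriv_def fun_eq_iff field_zero)

lemma dir_deriv_scale:
  "X \<in> fields \<Longrightarrow> f \<in> smooth \<Longrightarrow> dir_deriv X (\<lambda>q. c * f q) = (\<lambda>q. c * dir_deriv X f q)"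
  by (simp add: dir_deriv_def field_scale)

lemma dir_deriv_mult:
  "X \<in> fields \<Longrightarrow> f \<in> smooth \<Longrightarrow> h \<in> smooth \<Longrightarrow>
    dir_deriv X (f * h) = f * dir_deriv X h + h * dir_deriv X f"
  by (simp add: dir_deriv_def fun_eq_iff field_mult)

lemma fields_add [simp]:
  assumes "X \<in> fields" "Y \<in> fields" shows "X + Y \<in> fields"
proof (rule fieldsI)
  show "(\<lambda>p. (X + Y) p f) \<in> smooth" for f
    using smooth_add[OF smooth_dir_deriv[OF assms(1), of f] smooth_dir_deriv[OF assms(2), of f]]
    by (simp add: dir_deriv_def plus_fun_def)
qed (use assms in \<open>simp_all add: field_add field_scale field_mult field_nonsmooth algebra_simps\<close>)

lemma fields_fscale [simp]:
  assumes "f \<in> smooth" "X \<in> fields" shows "fscale f X \<in> fields"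
proof (rule fieldsI)
  show "(\<lambda>p. fscale f X p h) \<in> smooth" for h
    using smooth_mult[OF assms(1) smooth_dir_deriv[OF assms(2), of h]]
    by (simp add: dir_deriv_def times_fun_def fscale_def tscale_def)
qed (use assms in \<open>simp_all add: fscale_def tscale_def field_add field_scale field_mult
      field_nonsmooth algebra_simps\<close>)

lemma fields_zero [simp]: "0 \<in> fields"
  by (rule fieldsI) (simp_all flip: zero_fun_def)

lemma fields_minus [simp]: "X \<in> fields \<Longrightarrow> - X \<in> fields"
proof -
  assume "X \<in> fields"
  moreover have "- X = fscale (\<lambda>_. - 1) X"
    by (simp add: fscale_def tscale_def fun_eq_iff)
  ultimately show ?thesis by simp
qed

lemma fields_diff [simp]: "X \<in> fields \<Longrightarrow> Y \<in> fields \<Longrightarrow> X - Y \<in> fields"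
  using fields_add[of X "- Y"] by simp

lemma fields_vscale [simp]: "X \<in> fields \<Longrightarrow> vscale c X \<in> fields"
  by (simp add: vscale_def)

lemma fields_lie_bracket [simp]:
  assumes "X \<in> fields" "Y \<in> fields" shows "lie_bracket X Y \<in> fields"
proof (rule fieldsI)
  show "(\<lambda>p. lie_bracket X Y p f) \<in> smooth" for f
  proof -
    have "dir_deriv X (dir_deriv Y f) - dir_deriv Y (dir_deriv X f) \<in> smooth"
      using assms by simp
    then show ?thesis by (simp add: lie_bracket_def dir_deriv_def fun_diff_def)
  qed
  show "lie_bracket X Y p f = 0" if "f \<notin> smooth" for p f
  proof -
    have "dir_deriv X f = 0" "dir_deriv Y f = 0"
      using that assms by (simp_all add: dir_deriv_def field_nonsmooth fun_eq_iff)
    then show ?thesis using assms by (simp add: lie_bracket_def field_zero)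
  qed
  show "lie_bracket X Y p (f * h) = f p * lie_bracket X Y p h + h p * lie_bracket X Y p f"
    if "f \<in> smooth" "h \<in> smooth" for p f h
  proof -
    have "X p h = dir_deriv X h p" "Y p h = dir_deriv Y h p"
        "X p f = dir_deriv X f p" "Y p f = dir_deriv Y f p"
      by (simp_all add: dir_deriv_def)
    then show ?thesis
      using that assms by (simp add: lie_bracket_def dir_deriv_mult field_add field_mult algebra_simps)
  qed
qed (use assms in \<open>simp_all add: lie_bracket_def dir_deriv_add dir_deriv_scale field_add
      field_scale algebra_simps\<close>)

lemma dir_deriv_field_add: "dir_deriv (X + Y) f = dir_deriv X f + dir_deriv Y f"
  by (simp add: dir_deriv_def fun_eq_iff)

lemma dir_deriv_fscale: "dir_deriv (fscale f X) h = f * dir_deriv X h"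
  by (simp add: dir_deriv_def fscale_def tscale_def fun_eq_iff)

lemma dir_deriv_lie_bracket:
  "dir_deriv (lie_bracket X Y) f = dir_deriv X (dir_deriv Y f) - dir_deriv Y (dir_deriv X f)"
  by (simp add: dir_deriv_def lie_bracket_def fun_eq_iff)

lemma lie_bracket_skew: "lie_bracket X Y = - lie_bracket Y X"
  by (simp add: lie_bracket_def fun_eq_iff)

lemma lie_bracket_add_left:
  assumes "X \<in> fields" "Y \<in> fields" "Z \<in> fields"
  shows "lie_bracket (X + Y) Z = lie_bracket X Z + lie_bracket Y Z"
  using assms by (simp add: lie_bracket_def fun_eq_iff dir_deriv_field_add field_add)

lemma lie_bracket_fscale_left:
  assumes "f \<in> smooth" "X \<in> fields" "Y \<in> fields"
  shows "lie_bracket (fscale f X) Y = fscale f (lie_bracket X Y) - fscale (dir_deriv Y f) X"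
proof (intro ext)
  fix p h
  have "dir_deriv X h p = X p h" "dir_deriv Y f p = Y p f"
    by (simp_all add: dir_deriv_def)
  moreover have "lie_bracket (fscale f X) Y p h
      = f p * X p (dir_deriv Y h) - Y p (f * dir_deriv X h)"
    by (simp add: lie_bracket_def dir_deriv_fscale) (simp add: fscale_def tscale_def)
  ultimately show "lie_bracket (fscale f X) Y p h =
      (fscale f (lie_bracket X Y) - fscale (dir_deriv Y f) X) p h"
    using assms by (simp add: lie_bracket_def field_mult fscale_def tscale_def algebra_simps)
qed

lemma jacobi_identity:
  assumes "X \<in> fields" "Y \<in> fields" "Z \<in> fields"
  shows "lie_bracket (lie_bracket X Y) Z + lie_bracket (lie_bracket Y Z) X
    + lie_bracket (lie_bracket Z X) Y = 0"
proof (intro ext)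
  fix p f
  have *: "lie_bracket (lie_bracket U V) W p f =
      U p (dir_deriv V (dir_deriv W f)) - V p (dir_deriv U (dir_deriv W f))
      - W p (dir_deriv U (dir_deriv V f)) + W p (dir_deriv V (dir_deriv U f))"
    if "U \<in> fields" "V \<in> fields" "W \<in> fields" for U V W
  proof -
    have "lie_bracket (lie_bracket U V) W p f = lie_bracket U V p (dir_deriv W f)
        - W p (dir_deriv (lie_bracket U V) f)"
      by (simp add: lie_bracket_def[of "lie_bracket U V"])
    then show ?thesis
      using that by (simp add: dir_deriv_lie_bracket field_diff) (simp add: lie_bracket_def)
  qed
  show "(lie_bracket (lie_bracket X Y) Z + lie_bracket (lie_bracket Y Z) X
    + lie_bracket (lie_bracket Z X) Y) p f = 0 p f"
    using assms by (simp add: *)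
qed

end


section \<open>Covariant derivatives and curvature\<close>

lemma fscale_add: "fscale f (X + Y) = fscale f X + fscale f Y"
  by (simp add: fscale_def tscale_def fun_eq_iff algebra_simps)

lemma fscale_diff: "fscale f (X - Y) = fscale f X - fscale f Y"
  by (simp add: fscale_def tscale_def fun_eq_iff algebra_simps)

lemma fscale_diff_left: "fscale (f - h) X = fscale f X - fscale h X"
  by (simp add: fscale_def tscale_def fun_eq_iff algebra_simps)

lemma vscale_add: "vscale c (X + Y) = vscale c X + vscale c Y"
  by (simp add: vscale_def fscale_add)

lemma vscale_fscale: "vscale c (fscale f X) = fscale f (vscale c X)"
  by (simp add: vscale_def fscale_def tscale_def fun_eq_iff)

locale metric_atlas = smooth_atlas A
  for A :: "('m::{t2_space,second_countable_topology}, 'e::euclidean_space) chart set" +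
  fixes g :: "'m bilin_field"
  assumes metric: "pseudo_riemannian_metric A g"
begin

lemma field_tangent: "X \<in> fields \<Longrightarrow> X p \<in> tangent_space A p"
  by (simp add: vector_fields_def)

lemma app2_smooth [simp]: "X \<in> fields \<Longrightarrow> Y \<in> fields \<Longrightarrow> app2 g X Y \<in> smooth"
  using metric by (simp add: pseudo_riemannian_metric_def)

lemma app2_commute: "X \<in> fields \<Longrightarrow> Y \<in> fields \<Longrightarrow> app2 g X Y = app2 g Y X"
  using metric by (simp add: pseudo_riemannian_metric_def app2_def field_tangent fun_eq_iff)

lemma app2_add_left:
  "X \<in> fields \<Longrightarrow> Y \<in> fields \<Longrightarrow> Z \<in> fields \<Longrightarrow> app2 g (X + Y) Z = app2 g X Z + app2 g Y Z"
  using metric by (simp add: pseudo_riemannian_metric_def app2_def field_tangent fun_eq_iff)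

lemma app2_fscale_left:
  "X \<in> fields \<Longrightarrow> Y \<in> fields \<Longrightarrow> app2 g (fscale f X) Y = f * app2 g X Y"
  using metric
  by (simp add: pseudo_riemannian_metric_def app2_def fscale_def field_tangent fun_eq_iff)

lemma app2_add_right:
  "X \<in> fields \<Longrightarrow> Y \<in> fields \<Longrightarrow> Z \<in> fields \<Longrightarrow> app2 g Z (X + Y) = app2 g Z X + app2 g Z Y"
  using app2_add_left[of X Y Z] by (simp add: app2_commute[of Z])

lemma app2_fscale_right:
  "f \<in> smooth \<Longrightarrow> X \<in> fields \<Longrightarrow> Y \<in> fields \<Longrightarrow> app2 g Y (fscale f X) = f * app2 g Y X"
  using app2_fscale_left[of X Y f] by (simp add: app2_commute[of Y])

lemma app2_diff_left:
  "X \<in> fields \<Longrightarrow> Y \<in> fields \<Longrightarrow> Z \<in> fields \<Longrightarrow> app2 g (X - Y) Z = app2 g X Z - app2 g Y Z"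
  using app2_add_left[of "X - Y" Y Z] by simp

lemma app2_zero_left: "Z \<in> fields \<Longrightarrow> app2 g 0 Z = 0"
  using app2_diff_left[of Z Z Z] by simp

lemma app2_minus_left: "X \<in> fields \<Longrightarrow> Z \<in> fields \<Longrightarrow> app2 g (- X) Z = - app2 g X Z"
  using app2_diff_left[of 0 X Z] by (simp add: app2_zero_left)

lemma app2_minus_right: "X \<in> fields \<Longrightarrow> Z \<in> fields \<Longrightarrow> app2 g Z (- X) = - app2 g Z X"
  using app2_minus_left[of X Z] by (simp add: app2_commute[of Z])

lemma app2_vscale_left:
  "X \<in> fields \<Longrightarrow> Y \<in> fields \<Longrightarrow> app2 g (vscale c X) Y p = c * app2 g X Y p"
  by (simp add: vscale_def app2_fscale_left)

end

locale connection_atlas = metric_atlas A g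
  for A :: "('m::{t2_space,second_countable_topology}, 'e::euclidean_space) chart set" and g +
  fixes D :: "'m connection"
  assumes connection: "linear_connection A D"
begin

lemma conn_fields [simp]: "x \<in> fields \<Longrightarrow> y \<in> fields \<Longrightarrow> D x y \<in> fields"
  using connection by (simp add: linear_connection_def)

lemma conn_add:
  assumes "x \<in> fields" "y \<in> fields" "z \<in> fields"
  shows "D (x + y) z = D x z + D y z" "D x (y + z) = D x y + D x z"
  using connection assms by (simp_all add: linear_connection_def)

lemma conn_fscale_left:
  "f \<in> smooth \<Longrightarrow> x \<in> fields \<Longrightarrow> y \<in> fields \<Longrightarrow> D (fscale f x) y = fscale f (D x y)"
  using connection by (simp add: linear_connection_def)

lemma conn_fscale_right:
  "f \<in> smooth \<Longrightarrow> x \<in> fields \<Longrightarrow> y \<in> fields \<Longrightarrow>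
    D x (fscale f y) = fscale (dir_deriv x f) y + fscale f (D x y)"
  using connection by (simp add: linear_connection_def)

lemma conn_diff:
  assumes "x \<in> fields" "y \<in> fields" "z \<in> fields"
  shows "D (x - y) z = D x z - D y z" "D x (y - z) = D x y - D x z"
  using assms conn_add(1)[of "x - y" y z] conn_add(2)[of x "y - z" z] by simp_all

lemma conn_zero: "x \<in> fields \<Longrightarrow> D 0 x = 0" "x \<in> fields \<Longrightarrow> D x 0 = 0"
  using conn_diff(1)[of x x x] conn_diff(2)[of x x x] by simp_all

lemma conn_minus:
  assumes "x \<in> fields" "y \<in> fields"
  shows "D (- x) y = - D x y" "D x (- y) = - D x y"
  using assms conn_diff(1)[of 0 x y] conn_diff(2)[of x 0 y] by (simp_all add: conn_zero)

lemma curvature_fields [simp]: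
  "x \<in> fields \<Longrightarrow> y \<in> fields \<Longrightarrow> z \<in> fields \<Longrightarrow> curvature D x y z \<in> fields"
  by (simp add: curvature_def)

text \<open>Only the first and third slots of the curvature need a computation of tensoriality; the
  second one follows by skew-symmetry and the fourth one is plain linearity of \<open>g\<close>.\<close>

lemma curvature_skew:
  assumes "x \<in> fields" "y \<in> fields" "z \<in> fields"
  shows "curvature D x y z = - curvature D y x z"
  using assms by (simp add: curvature_def lie_bracket_skew[of x y] conn_minus)

lemma curvature04_skew12:
  assumes "x \<in> fields" "y \<in> fields" "z \<in> fields" "w \<in> fields"
  shows "curvature04 g D x y z w = - curvature04 g D y x z w"
  using assms by (simp add: curvature04_def curvature_skew[of x y] app2_minus_left)

lemma curvature_add_first:
  assumes "x \<in> fields" "u \<in> fields" "y \<in> fields" "z \<in> fields"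
  shows "curvature D (x + u) y z = curvature D x y z + curvature D u y z"
  using assms by (simp add: curvature_def lie_bracket_add_left conn_add)

lemma curvature_add_third:
  assumes "x \<in> fields" "u \<in> fields" "y \<in> fields" "z \<in> fields"
  shows "curvature D x y (z + u) = curvature D x y z + curvature D x y u"
  using assms by (simp add: curvature_def conn_add)

lemma curvature_fscale_first:
  assumes "f \<in> smooth" "x \<in> fields" "y \<in> fields" "z \<in> fields"
  shows "curvature D (fscale f x) y z = fscale f (curvature D x y z)"
  using assms by (simp add: curvature_def lie_bracket_fscale_left conn_diff conn_fscale_left
      conn_fscale_right fscale_diff)

lemma curvature_fscale_third:
  assumes "f \<in> smooth" "x \<in> fields" "y \<in> fields" "z \<in> fields"
  shows "curvature D x y (fscale f z) = fscale f (curvature D x y z)"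
  using assms by (simp add: curvature_def conn_add conn_fscale_right fscale_diff
      dir_deriv_lie_bracket fscale_diff_left)

lemma tensor04_curvature04: "tensor04 A (curvature04 g D)"
proof -
  have 1: "function_linear A (\<lambda>u. curvature04 g D u x y z)"
    if "x \<in> fields" "y \<in> fields" "z \<in> fields" for x y z
    using that by (simp add: function_linear_def curvature04_def curvature_add_first
        curvature_fscale_first app2_add_left app2_fscale_left)
  have "function_linear A (\<lambda>u. curvature04 g D x u y z)"
    if "x \<in> fields" "y \<in> fields" "z \<in> fields" for x y z
    using 1[OF that] that by (simp add: function_linear_def curvature04_skew12[of x])
  moreover have "function_linear A (\<lambda>u. curvature04 g D x y u z)"
    "function_linear A (\<lambda>u. curvature04 g D x y z u)"
    if "x \<in> fields" "y \<in> fields" "z \<in> fields" for x y z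
    using that by (simp_all add: function_linear_def curvature04_def curvature_add_third
        curvature_fscale_third app2_add_left app2_fscale_left app2_add_right app2_fscale_right)
  ultimately show ?thesis
    using 1 by (simp add: tensor04_def)
qed

end

locale metric_connection_atlas = connection_atlas A g D
  for A :: "('m::{t2_space,second_countable_topology}, 'e::euclidean_space) chart set" and g D +
  assumes metric_compatible: "x \<in> fields \<Longrightarrow> y \<in> fields \<Longrightarrow> z \<in> fields \<Longrightarrow>
    dir_deriv x (app2 g y z) = app2 g (D x y) z + app2 g y (D x z)"
begin

text \<open>Differentiate the function \<open>g(z,w)\<close> along \<open>x\<close> and \<open>y\<close>: as \<open>[x,y]\<close> is the commutator of the two
  derivations, all terms other than \<open>R(x,y,z,w) + R(x,y,w,z)\<close> cancel.\<close>

lemma curvature04_skew34: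
  assumes "x \<in> fields" "y \<in> fields" "z \<in> fields" "w \<in> fields"
  shows "curvature04 g D x y z w = - curvature04 g D x y w z"
proof -
  have second: "dir_deriv u (dir_deriv v (app2 g z w)) = app2 g (D u (D v z)) w
      + app2 g (D v z) (D u w) + (app2 g (D u z) (D v w) + app2 g z (D u (D v w)))"
    if "u \<in> fields" "v \<in> fields" for u v
    using assms that by (simp add: metric_compatible dir_deriv_add)
  have first: "dir_deriv (lie_bracket x y) (app2 g z w)
      = app2 g (D (lie_bracket x y) z) w + app2 g z (D (lie_bracket x y) w)"
    using assms by (simp add: metric_compatible)
  show ?thesis
  proof
    fix p
    show "curvature04 g D x y z w p = (- curvature04 g D x y w z) p"
      using fun_cong[OF first, of p] fun_cong[OF second[OF assms(1,2)], of p]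
        fun_cong[OF second[OF assms(2,1)], of p] assms
      by (simp add: curvature04_def dir_deriv_lie_bracket curvature_def app2_diff_left
          app2_commute[of z])
  qed
qed

text \<open>The curvature of a metric connection commutes with any parallel \<open>g\<close>-symmetric field \<open>K\<close> of
  endomorphisms. Both parallelism and the conclusion are stated in terms of \<open>g\<close>, with \<open>K\<close> moved to
  the other argument. The point is that a second covariant derivative paired with \<open>w\<close> depends only
  on the pairings of the first one with vector fields.\<close>

lemma curvature04_symmetric_parallel:
  assumes K: "\<And>x. x \<in> fields \<Longrightarrow> K x \<in> fields"
    and sym: "\<And>x y. x \<in> fields \<Longrightarrow> y \<in> fields \<Longrightarrow> app2 g (K x) y = app2 g x (K y)"
    and parallel: "\<And>x y z. x \<in> fields \<Longrightarrow> y \<in> fields \<Longrightarrow> z \<in> fields \<Longrightarrow>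
      app2 g (D x (K y)) z = app2 g (D x y) (K z)"
    and fields: "x \<in> fields" "y \<in> fields" "z \<in> fields" "w \<in> fields"
  shows "curvature04 g D x y (K z) w = curvature04 g D x y z (K w)"
proof -
  have second: "app2 g (D u (D v (K z))) w = app2 g (D u (D v z)) (K w)"
    if "u \<in> fields" "v \<in> fields" for u v
  proof -
    have "app2 g (D u (D v (K z))) w
        = dir_deriv u (app2 g (D v (K z)) w) - app2 g (D v (K z)) (D u w)"
      using fields that K by (simp add: metric_compatible)
    also have "\<dots> = dir_deriv u (app2 g (D v z) (K w)) - app2 g (D v z) (K (D u w))"
      using fields that K by (simp add: parallel)
    also have "app2 g (D v z) (K (D u w)) = app2 g (D u (K w)) (D v z)"
      using fields that K parallel[of u w "D v z"] sym[of "D u w" "D v z"]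
      by (simp add: app2_commute[of "D v z"])
    also have "dir_deriv u (app2 g (D v z) (K w)) - app2 g (D u (K w)) (D v z)
        = app2 g (D u (D v z)) (K w)"
      using fields that K by (simp add: metric_compatible app2_commute[of "D u (K w)"])
    finally show ?thesis .
  qed
  show ?thesis
    using fields K by (simp add: curvature04_def curvature_def app2_diff_left second parallel)
qed

end

locale levi_civita_atlas = metric_connection_atlas A g D
  for A :: "('m::{t2_space,second_countable_topology}, 'e::euclidean_space) chart set" and g D +
  assumes torsion_free: "x \<in> fields \<Longrightarrow> y \<in> fields \<Longrightarrow> lie_bracket x y = D x y - D y x"
begin

text \<open>Replacing every bracket by its torsion-free expression, except for one nested bracket in each
  term, reduces the cyclic sum to the Jacobi identity.\<close>

lemma first_bianchi:
  assumes "x \<in> fields" "y \<in> fields" "z \<in> fields"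
  shows "curvature D x y z + curvature D y z x + curvature D z x y = 0"
proof -
  have R: "curvature D u v w = D u (D v w) - D v (D u w) - (D w (D u v) - D w (D v u))
      - lie_bracket (lie_bracket u v) w"
    if "u \<in> fields" "v \<in> fields" "w \<in> fields" for u v w
  proof -
    have "D (lie_bracket u v) w = lie_bracket (lie_bracket u v) w + D w (lie_bracket u v)"
      using that torsion_free[of "lie_bracket u v" w] by simp
    moreover have "D w (lie_bracket u v) = D w (D u v) - D w (D v u)"
      using that by (simp add: torsion_free conn_diff)
    ultimately show ?thesis by (simp add: curvature_def algebra_simps)
  qed
  have "curvature D x y z + curvature D y z x + curvature D z x y
    = - (lie_bracket (lie_bracket x y) z + lie_bracket (lie_bracket y z) x
      + lie_bracket (lie_bracket z x) y)"
    using assms by (simp only: R) (simp add: algebra_simps)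
  then show ?thesis using jacobi_identity[OF assms] by simp
qed

lemma curvature04_bianchi:
  assumes "x \<in> fields" "y \<in> fields" "z \<in> fields" "w \<in> fields"
  shows "curvature04 g D x y z w + curvature04 g D y z x w + curvature04 g D z x y w = 0"
  using arg_cong[OF first_bianchi[OF assms(1-3)], of "\<lambda>v. app2 g v w"] assms
  by (simp add: curvature04_def app2_add_left app2_zero_left)

end


section \<open>Connections with totally skew-symmetric torsion\<close>

text \<open>The octahedron argument: combine the Bianchi identities of the four cyclic arrangements of
  \<open>x, y, z, w\<close>.\<close>

lemma pair_symmetry:
  fixes R :: "'v \<Rightarrow> 'v \<Rightarrow> 'v \<Rightarrow> 'v \<Rightarrow> real"
  assumes skew12: "\<And>x y z w. x \<in> V \<Longrightarrow> y \<in> V \<Longrightarrow> z \<in> V \<Longrightarrow> w \<in> V \<Longrightarrow> R x y z w = - R y x z w"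
    and skew34: "\<And>x y z w. x \<in> V \<Longrightarrow> y \<in> V \<Longrightarrow> z \<in> V \<Longrightarrow> w \<in> V \<Longrightarrow> R x y z w = - R x y w z"
    and bianchi: "\<And>x y z w. x \<in> V \<Longrightarrow> y \<in> V \<Longrightarrow> z \<in> V \<Longrightarrow> w \<in> V \<Longrightarrow>
      R x y z w + R y z x w + R z x y w = 0"
    and V: "x \<in> V" "y \<in> V" "z \<in> V" "w \<in> V"
  shows "R x y z w = R z w x y"
proof -
  have "R x y z w + R y z x w + R z x y w = 0" "R y z w x + R z w y x + R w y z x = 0"
    "R z w x y + R w x z y + R x z w y = 0" "R w x y z + R x y w z + R y w x z = 0"
    using bianchi V by blast+
  moreover have "R y z w x = - R y z x w" "R z w y x = - R z w x y" "R x y w z = - R x y z w"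
    "R w x z y = - R w x y z" "R w y z x = - R w y x z" "R y w x z = - R w y x z"
    "R x z w y = - R x z y w" "R z x y w = - R x z y w"
    using skew12 skew34 V by blast+
  ultimately show ?thesis by linarith
qed

text \<open>The pointwise linear algebra of the theorem: \<open>C\<close> plays the part of \<open>\<nabla>Q\<close> and \<open>B\<close> that of
  \<open>g(Q(x,y),Q(z,w))\<close>. The set \<open>V\<close> is arbitrary because the argument only permutes the four
  entries.\<close>

lemma bianchi_iff_curvature_formula:
  fixes R R' C B :: "'v \<Rightarrow> 'v \<Rightarrow> 'v \<Rightarrow> 'v \<Rightarrow> real"
  assumes R12: "\<And>x y z w. x \<in> V \<Longrightarrow> y \<in> V \<Longrightarrow> z \<in> V \<Longrightarrow> w \<in> V \<Longrightarrow> R x y z w = - R y x z w"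
    and R34: "\<And>x y z w. x \<in> V \<Longrightarrow> y \<in> V \<Longrightarrow> z \<in> V \<Longrightarrow> w \<in> V \<Longrightarrow> R x y z w = - R x y w z"
    and R_bianchi: "\<And>x y z w. x \<in> V \<Longrightarrow> y \<in> V \<Longrightarrow> z \<in> V \<Longrightarrow> w \<in> V \<Longrightarrow>
      R x y z w + R y z x w + R z x y w = 0"
    and R'12: "\<And>x y z w. x \<in> V \<Longrightarrow> y \<in> V \<Longrightarrow> z \<in> V \<Longrightarrow> w \<in> V \<Longrightarrow> R' x y z w = - R' y x z w"
    and R'34: "\<And>x y z w. x \<in> V \<Longrightarrow> y \<in> V \<Longrightarrow> z \<in> V \<Longrightarrow> w \<in> V \<Longrightarrow> R' x y z w = - R' x y w z"
    and C23: "\<And>x y z w. x \<in> V \<Longrightarrow> y \<in> V \<Longrightarrow> z \<in> V \<Longrightarrow> w \<in> V \<Longrightarrow> C x y z w = - C x z y w"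
    and C34: "\<And>x y z w. x \<in> V \<Longrightarrow> y \<in> V \<Longrightarrow> z \<in> V \<Longrightarrow> w \<in> V \<Longrightarrow> C x y z w = - C x y w z"
    and B12: "\<And>x y z w. x \<in> V \<Longrightarrow> y \<in> V \<Longrightarrow> z \<in> V \<Longrightarrow> w \<in> V \<Longrightarrow> B x y z w = - B y x z w"
    and B34: "\<And>x y z w. x \<in> V \<Longrightarrow> y \<in> V \<Longrightarrow> z \<in> V \<Longrightarrow> w \<in> V \<Longrightarrow> B x y z w = - B x y w z"
    and B_sym: "\<And>x y z w. x \<in> V \<Longrightarrow> y \<in> V \<Longrightarrow> z \<in> V \<Longrightarrow> w \<in> V \<Longrightarrow> B x y z w = B z w x y"
    and R'_eq: "\<And>x y z w. x \<in> V \<Longrightarrow> y \<in> V \<Longrightarrow> z \<in> V \<Longrightarrow> w \<in> V \<Longrightarrow>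
      R' x y z w = R x y z w + C x y z w - C y x z w - B y z x w - B z x y w"
  shows "(\<forall>x\<in>V. \<forall>y\<in>V. \<forall>z\<in>V. \<forall>w\<in>V. R' x y z w + R' y z x w + R' z x y w = 0) \<longleftrightarrow>
    (\<forall>x\<in>V. \<forall>y\<in>V. \<forall>z\<in>V. \<forall>w\<in>V.
      3 * R' x y z w = 3 * R x y z w + 2 * B x y z w + B z y x w + B x z y w)"
    (is "?bianchi \<longleftrightarrow> ?formula")
proof
  assume ?formula
  show ?bianchi
  proof (intro ballI)
    fix x y z w assume V: "x \<in> V" "y \<in> V" "z \<in> V" "w \<in> V"
    have "3 * R' x y z w = 3 * R x y z w + 2 * B x y z w + B z y x w + B x z y w"
      "3 * R' y z x w = 3 * R y z x w + 2 * B y z x w + B x z y w + B y x z w"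
      "3 * R' z x y w = 3 * R z x y w + 2 * B z x y w + B y x z w + B z y x w"
      using \<open>?formula\<close> V by blast+
    moreover have "B z y x w = - B y z x w" "B x z y w = - B z x y w" "B y x z w = - B x y z w"
      using B12 V by blast+
    ultimately show "R' x y z w + R' y z x w + R' z x y w = 0"
      using R_bianchi[OF V] by linarith
  qed
next
  assume ?bianchi
  then have R'_bianchi: "R' x y z w + R' y z x w + R' z x y w = 0"
    if "x \<in> V" "y \<in> V" "z \<in> V" "w \<in> V" for x y z w
    using that by blast
  show ?formula
  proof (intro ballI)
    fix x y z w assume V: "x \<in> V" "y \<in> V" "z \<in> V" "w \<in> V"
    let ?\<sigma> = "B x y z w + B y z x w + B z x y w"
    have cyclic: "C x y z w + C y z x w + C z x y w = ?\<sigma>"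
    proof -
      have "R' x y z w + R' y z x w + R' z x y w = 0"
        using R'_bianchi V by blast
      moreover have "C y x z w = - C y z x w" "C z y x w = - C z x y w" "C x z y w = - C x y z w"
        using C23 V by blast+
      ultimately show ?thesis
        using R_bianchi[OF V] R'_eq[of x y z w] R'_eq[of y z x w] R'_eq[of z x y w] V by linarith
    qed
    \<comment> \<open>Pair symmetry of \<open>R' - R\<close>; the terms in \<open>B\<close> are pair symmetric by themselves and drop out.\<close>
    have pairs: "C x y z w + C y z x w = C z x y w - C w x y z"
      if V: "x \<in> V" "y \<in> V" "z \<in> V" "w \<in> V" for x y z w
    proof -
      have "R x y z w = R z w x y"
        by (rule pair_symmetry[OF R12 R34 R_bianchi V])
      moreover have "R' x y z w = R' z w x y"
        by (rule pair_symmetry[OF R'12 R'34 R'_bianchi V])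
      moreover have "C y x z w = - C y z x w" "C z w x y = C z x y w" "C w z x y = C w x y z"
        using C23[of y x z w] C23[of z w x y] C34[of z x w y] C23[of w z x y] C34[of w x z y] V
        by simp_all
      moreover have "B w x z y = B y z x w" "B x z w y = B z x y w"
        using B_sym[of w x z y] B12[of z y w x] B34[of y z w x] B12[of x z w y] B34[of z x w y] V
        by simp_all
      ultimately show ?thesis
        using R'_eq[of x y z w] R'_eq[of z w x y] V by linarith
    qed
    \<comment> \<open>Rotating \<open>x, y, z\<close> in this relation leaves \<open>C w x y z\<close> fixed, so that the three
      cyclic terms of \<open>C\<close> agree and each of them is a third of their sum.\<close>
    have "C x y z w = C z x y w" "C y z x w = C z x y w"
    proof -
      have "C x y z w + C y z x w = C z x y w - C w x y z"
        "C y z x w + C z x y w = C x y z w - C w y z x"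
        "C z x y w + C x y z w = C y z x w - C w z x y"
        using pairs V by blast+
      moreover have "C w y z x = C w x y z" "C w z x y = C w x y z"
        using C34[of w y z x] C23[of w y x z] C23[of w z x y] C34[of w x z y] V by simp_all
      ultimately show "C x y z w = C z x y w" "C y z x w = C z x y w"
        by linarith+
    qed
    moreover have "C y x z w = - C y z x w" "B z y x w = - B y z x w" "B x z y w = - B z x y w"
      using C23 B12 V by blast+
    ultimately show "3 * R' x y z w = 3 * R x y z w + 2 * B x y z w + B z y x w + B x z y w"
      using cyclic R'_eq[OF V] by linarith
  qed
qed

text \<open>The torsion of \<open>D + Q\<close> is \<open>2 Q\<close>, so these assumptions on \<open>Q\<close> say that it is a 3-form.\<close>

locale skew_torsion_atlas = levi_civita_atlas A g D
  for A :: "('m::{t2_space,second_countable_topology}, 'e::euclidean_space) chart set" and g D +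
  fixes Q :: "'m connection"
  assumes Q_fields [simp]: "x \<in> fields \<Longrightarrow> y \<in> fields \<Longrightarrow> Q x y \<in> fields"
    and Q_add_left: "x \<in> fields \<Longrightarrow> y \<in> fields \<Longrightarrow> z \<in> fields \<Longrightarrow> Q (x + y) z = Q x z + Q y z"
    and Q_add_right: "x \<in> fields \<Longrightarrow> y \<in> fields \<Longrightarrow> z \<in> fields \<Longrightarrow> Q x (y + z) = Q x y + Q x z"
    and Q_fscale_left: "f \<in> smooth \<Longrightarrow> x \<in> fields \<Longrightarrow> y \<in> fields \<Longrightarrow>
      Q (fscale f x) y = fscale f (Q x y)"
    and Q_fscale_right: "f \<in> smooth \<Longrightarrow> x \<in> fields \<Longrightarrow> y \<in> fields \<Longrightarrow>
      Q x (fscale f y) = fscale f (Q x y)"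
    and Q_skew12: "x \<in> fields \<Longrightarrow> y \<in> fields \<Longrightarrow> z \<in> fields \<Longrightarrow>
      app2 g (Q x y) z = - app2 g (Q y x) z"
    and Q_skew23: "x \<in> fields \<Longrightarrow> y \<in> fields \<Longrightarrow> z \<in> fields \<Longrightarrow>
      app2 g (Q x y) z = - app2 g (Q x z) y"
begin

definition conn' :: "'m connection" where
  "conn' x y = D x y + Q x y"

sublocale conn': metric_connection_atlas A g conn'
proof
  have "conn' (x + y) z = conn' x z + conn' y z" "conn' x (y + z) = conn' x y + conn' x z"
    if "x \<in> fields" "y \<in> fields" "z \<in> fields" for x y z
    using that by (simp_all add: conn'_def conn_add Q_add_left Q_add_right ac_simps)
  moreover have "conn' (fscale f x) y = fscale f (conn' x y)"
    "conn' x (fscale f y) = fscale (dir_deriv x f) y + fscale f (conn' x y)"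
    if "f \<in> smooth" "x \<in> fields" "y \<in> fields" for f x y
    using that by (simp_all add: conn'_def conn_fscale_left conn_fscale_right Q_fscale_left
        Q_fscale_right fscale_add ac_simps)
  moreover have "conn' x y \<in> fields" if "x \<in> fields" "y \<in> fields" for x y
    using that by (simp add: conn'_def)
  ultimately show "linear_connection A conn'"
    unfolding linear_connection_def by blast
  show "dir_deriv x (app2 g y z) = app2 g (conn' x y) z + app2 g y (conn' x z)"
    if f: "x \<in> fields" "y \<in> fields" "z \<in> fields" for x y z
  proof -
    have "app2 g (Q x y) z + app2 g y (Q x z) = 0"
      using f Q_skew23[of x y z] by (simp add: app2_commute[of y])
    then show ?thesis
      using f by (simp add: conn'_def metric_compatible app2_add_left app2_add_right add_eq_0_iff)
  qed
qed

definition nabla_Q :: "'m field04" where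
  "nabla_Q x y z w = dir_deriv x (app2 g (Q y z) w)
     - app2 g (Q (D x y) z) w - app2 g (Q y (D x z)) w - app2 g (Q y z) (D x w)"

lemma nabla_Q_skew:
  assumes "x \<in> fields" "y \<in> fields" "z \<in> fields" "w \<in> fields"
  shows "nabla_Q x y z w = - nabla_Q x z y w" "nabla_Q x y z w = - nabla_Q x y w z"
proof -
  have "app2 g (Q y z) w = - app2 g (Q z y) w" "app2 g (Q (D x y) z) w = - app2 g (Q z (D x y)) w"
    "app2 g (Q y (D x z)) w = - app2 g (Q (D x z) y) w"
    "app2 g (Q y z) (D x w) = - app2 g (Q z y) (D x w)"
    by (rule Q_skew12; simp add: assms)+
  then show "nabla_Q x y z w = - nabla_Q x z y w"
    using assms by (simp add: nabla_Q_def dir_deriv_minus)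
  have "app2 g (Q y z) w = - app2 g (Q y w) z" "app2 g (Q (D x y) z) w = - app2 g (Q (D x y) w) z"
    "app2 g (Q y (D x z)) w = - app2 g (Q y w) (D x z)"
    "app2 g (Q y z) (D x w) = - app2 g (Q y (D x w)) z"
    by (rule Q_skew23; simp add: assms)+
  then show "nabla_Q x y z w = - nabla_Q x y w z"
    using assms by (simp add: nabla_Q_def dir_deriv_minus)
qed

text \<open>The derivatives of \<open>Q\<close> combine to \<open>\<nabla>Q\<close> by \<open>[x,y] = \<nabla>\<^sub>xy - \<nabla>\<^sub>yx\<close>, and skew-symmetry turns
  \<open>g(Q(x,Q(y,z)),w)\<close> into \<open>-g(Q(x,w),Q(y,z))\<close>.\<close>

lemma curvature04_conn':
  assumes "x \<in> fields" "y \<in> fields" "z \<in> fields" "w \<in> fields"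
  shows "curvature04 g conn' x y z w = curvature04 g D x y z w
    + nabla_Q x y z w - nabla_Q y x z w
    - app2 g (Q y z) (Q x w) - app2 g (Q z x) (Q y w)"
proof -
  have second: "app2 g (conn' u (conn' v z)) w = app2 g (D u (D v z)) w
      + (nabla_Q u v z w + app2 g (Q (D u v) z) w + app2 g (Q v (D u z)) w)
      + app2 g (Q u (D v z)) w - app2 g (Q v z) (Q u w)"
    if "u \<in> fields" "v \<in> fields" for u v
  proof -
    have "app2 g (Q u (Q v z)) w = - app2 g (Q u w) (Q v z)"
      using assms that by (intro Q_skew23) simp_all
    then show ?thesis
      using assms that
      by (simp add: conn'_def conn_add Q_add_right app2_add_left nabla_Q_def metric_compatible
          app2_commute[of "Q v z" "Q u w"] algebra_simps)
  qed
  have "Q (lie_bracket x y) z = Q (D x y) z - Q (D y x) z"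
    using assms Q_add_left[of "lie_bracket x y" "D y x" z] by (simp add: torsion_free)
  then have first: "app2 g (conn' (lie_bracket x y) z) w = app2 g (D (lie_bracket x y) z) w
      + (app2 g (Q (D x y) z) w - app2 g (Q (D y x) z) w)"
    using assms by (simp add: conn'_def app2_add_left app2_diff_left)
  have "app2 g (Q z x) (Q y w) = - app2 g (Q x z) (Q y w)"
    using assms by (intro Q_skew12) simp_all
  then show ?thesis
    using assms second[of x y] second[of y x] first
    by (simp add: curvature04_def curvature_def app2_diff_left)
qed

text \<open>The curvature of a metric connection already has all properties of a curvature-like tensor
  except the Bianchi identity.\<close>

theorem curvature_like_conn'_iff:
  "curvature_like A (curvature04 g conn') \<longleftrightarrow>
    (\<forall>x\<in>fields. \<forall>y\<in>fields. \<forall>z\<in>fields. \<forall>w\<in>fields. \<forall>p.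
      3 * curvature04 g conn' x y z w p = 3 * curvature04 g D x y z w p
        + 2 * app2 g (Q x y) (Q z w) p + app2 g (Q z y) (Q x w) p + app2 g (Q x z) (Q y w) p)"
proof -
  have *: "(\<forall>x\<in>fields. \<forall>y\<in>fields. \<forall>z\<in>fields. \<forall>w\<in>fields.
      curvature04 g conn' x y z w p + curvature04 g conn' y z x w p + curvature04 g conn' z x y w p = 0)
    \<longleftrightarrow> (\<forall>x\<in>fields. \<forall>y\<in>fields. \<forall>z\<in>fields. \<forall>w\<in>fields.
      3 * curvature04 g conn' x y z w p = 3 * curvature04 g D x y z w p
        + 2 * app2 g (Q x y) (Q z w) p + app2 g (Q z y) (Q x w) p + app2 g (Q x z) (Q y w) p)" for p
  proof (rule bianchi_iff_curvature_formula[where C = "\<lambda>x y z w. nabla_Q x y z w p"])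
    fix x y z w
    assume f: "x \<in> fields" "y \<in> fields" "z \<in> fields" "w \<in> fields"
    show "curvature04 g D x y z w p = - curvature04 g D y x z w p"
      using curvature04_skew12[OF f] by simp
    show "curvature04 g D x y z w p = - curvature04 g D x y w z p"
      using curvature04_skew34[OF f] by simp
    show "curvature04 g D x y z w p + curvature04 g D y z x w p + curvature04 g D z x y w p = 0"
      using fun_cong[OF curvature04_bianchi[OF f], of p] by simp
    show "curvature04 g conn' x y z w p = - curvature04 g conn' y x z w p"
      using conn'.curvature04_skew12[OF f] by simp
    show "curvature04 g conn' x y z w p = - curvature04 g conn' x y w z p"
      using conn'.curvature04_skew34[OF f] by simp
    show "nabla_Q x y z w p = - nabla_Q x z y w p" "nabla_Q x y z w p = - nabla_Q x y w z p"
      using nabla_Q_skew[OF f] by simp_all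
    show "app2 g (Q x y) (Q z w) p = - app2 g (Q y x) (Q z w) p"
      using f Q_skew12[of x y "Q z w"] by simp
    show "app2 g (Q x y) (Q z w) p = - app2 g (Q x y) (Q w z) p"
      using f Q_skew12[of z w "Q x y"] by (simp add: app2_commute[of "Q x y"])
    show "app2 g (Q x y) (Q z w) p = app2 g (Q z w) (Q x y) p"
      using f by (simp add: app2_commute)
    show "curvature04 g conn' x y z w p = curvature04 g D x y z w p
        + nabla_Q x y z w p - nabla_Q y x z w p
        - app2 g (Q y z) (Q x w) p - app2 g (Q z x) (Q y w) p"
      using curvature04_conn'[OF f] by simp
  qed
  have "curvature_like A (curvature04 g conn') \<longleftrightarrow>
    (\<forall>x\<in>fields. \<forall>y\<in>fields. \<forall>z\<in>fields. \<forall>w\<in>fields.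
      curvature04 g conn' x y z w + curvature04 g conn' y z x w + curvature04 g conn' z x y w = 0)"
    unfolding curvature_like_def
    using conn'.tensor04_curvature04 conn'.curvature04_skew12 conn'.curvature04_skew34 by blast
  also have "\<dots> \<longleftrightarrow> (\<forall>p. \<forall>x\<in>fields. \<forall>y\<in>fields. \<forall>z\<in>fields. \<forall>w\<in>fields.
      curvature04 g conn' x y z w p + curvature04 g conn' y z x w p
        + curvature04 g conn' z x y w p = 0)"
    by (auto simp: fun_eq_iff)
  finally show ?thesis
    unfolding * by blast
qed

end


section \<open>Quasi-Kaehler manifolds with Norden metric\<close>

locale W3_atlas = levi_civita_atlas A g D
  for A :: "('m::{t2_space,second_countable_topology}, 'e::euclidean_space) chart set" and g D +
  fixes J :: "'m endo_field"
  assumes norden: "almost_complex_norden A J g"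
    and F_cyclic: "x \<in> fields \<Longrightarrow> y \<in> fields \<Longrightarrow> z \<in> fields \<Longrightarrow>
      tensor_F g D J x y z + tensor_F g D J y z x + tensor_F g D J z x y = 0"
begin

abbreviation "jj \<equiv> app1 J"
abbreviation "nJ \<equiv> nabla_endo D J"
abbreviation "F \<equiv> tensor_F g D J"
abbreviation "Q \<equiv> Q_tensor D J"

lemma J_tensor: "tensor11 A J"
  using norden by (simp add: almost_complex_norden_def)

lemma J_fields [simp]: "x \<in> fields \<Longrightarrow> jj x \<in> fields"
  using J_tensor by (simp add: tensor11_def)

lemma J_add: "x \<in> fields \<Longrightarrow> y \<in> fields \<Longrightarrow> jj (x + y) = jj x + jj y"
  using J_tensor field_tangent[of x] field_tangent[of y]
  by (intro ext) (simp add: tensor11_def app1_def)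

lemma J_fscale: "x \<in> fields \<Longrightarrow> jj (fscale f x) = fscale f (jj x)"
  using J_tensor field_tangent[of x]
  by (auto simp: tensor11_def app1_def fscale_def)

lemma J_J: "x \<in> fields \<Longrightarrow> jj (jj x) = - x"
  using norden by (simp add: almost_complex_norden_def)

lemma J_diff: "x \<in> fields \<Longrightarrow> y \<in> fields \<Longrightarrow> jj (x - y) = jj x - jj y"
  using J_add[of "x - y" y] by simp

lemma metric_J_J: "x \<in> fields \<Longrightarrow> y \<in> fields \<Longrightarrow> app2 g (jj x) (jj y) = - app2 g x y"
  using norden by (simp add: almost_complex_norden_def)

lemma metric_J: "x \<in> fields \<Longrightarrow> y \<in> fields \<Longrightarrow> app2 g (jj x) y = app2 g x (jj y)"
  using metric_J_J[of x "jj y"] by (simp add: J_J app2_minus_right)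

lemma nJ_fields [simp]: "x \<in> fields \<Longrightarrow> y \<in> fields \<Longrightarrow> nJ x y \<in> fields"
  by (simp add: nabla_endo_def)

lemma nJ_add:
  assumes "x \<in> fields" "y \<in> fields" "z \<in> fields"
  shows "nJ (x + y) z = nJ x z + nJ y z" "nJ x (y + z) = nJ x y + nJ x z"
  using assms by (simp_all add: nabla_endo_def conn_add J_add)

lemma nJ_fscale:
  assumes "f \<in> smooth" "x \<in> fields" "y \<in> fields"
  shows "nJ (fscale f x) y = fscale f (nJ x y)" "nJ x (fscale f y) = fscale f (nJ x y)"
  using assms
  by (simp_all add: nabla_endo_def conn_fscale_left conn_fscale_right J_add J_fscale fscale_diff)

lemma nJ_J: "x \<in> fields \<Longrightarrow> y \<in> fields \<Longrightarrow> nJ x (jj y) = - jj (nJ x y)"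
  by (simp add: nabla_endo_def J_J conn_minus J_diff)

text \<open>This is the covariant derivative of \<open>g(Jy,z) = g(y,Jz)\<close>.\<close>

lemma F_sym:
  assumes "x \<in> fields" "y \<in> fields" "z \<in> fields"
  shows "F x y z = F x z y"
proof -
  have "app2 g (D x (jj y)) z + app2 g (jj y) (D x z) = app2 g (D x y) (jj z) + app2 g y (D x (jj z))"
    using assms metric_compatible[of x "jj y" z] metric_compatible[of x y "jj z"]
    by (simp add: metric_J)
  then show ?thesis
    using assms by (simp add: tensor_F_def nabla_endo_def app2_diff_left metric_J
        app2_commute[of y] app2_commute[of "jj y"] algebra_simps)
qed

lemma F_J: "x \<in> fields \<Longrightarrow> y \<in> fields \<Longrightarrow> z \<in> fields \<Longrightarrow> F x (jj y) z = - F x y (jj z)"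
  by (simp add: tensor_F_def nJ_J app2_minus_left metric_J)

lemma F_J_J: "x \<in> fields \<Longrightarrow> y \<in> fields \<Longrightarrow> z \<in> fields \<Longrightarrow> F x (jj y) (jj z) = F x y z"
  by (simp add: F_J J_J) (simp add: tensor_F_def app2_minus_right)

lemma Q_F:
  assumes "x \<in> fields" "y \<in> fields" "z \<in> fields"
  shows "4 * app2 g (Q x y) z p = F x (jj y) z p - F (jj x) y z p - 2 * F y (jj x) z p"
  using assms by (simp add: Q_tensor_def app2_vscale_left app2_diff_left tensor_F_def)

lemma cyclic_at:
  assumes "x \<in> fields" "y \<in> fields" "z \<in> fields"
  shows "F x y z p + F y z x p + F z x y p = 0"
  using fun_cong[OF F_cyclic[OF assms], of p] by simp

text \<open>Add the cyclic identities for \<open>(x,Jy,z)\<close> and \<open>(Jx,y,z)\<close>; the terms differentiated along \<open>z\<close>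
  cancel because \<open>F(z,Jx,y) = -F(z,x,Jy)\<close>.\<close>

lemma Q_skew_first:
  assumes "x \<in> fields" "y \<in> fields" "z \<in> fields"
  shows "app2 g (Q x y) z = - app2 g (Q y x) z"
proof
  fix p
  have "F x (jj y) z p + F (jj y) z x p + F z x (jj y) p = 0"
    "F (jj x) y z p + F y z (jj x) p + F z (jj x) y p = 0"
    using assms by (auto intro: cyclic_at)
  moreover have "F (jj y) z x p = F (jj y) x z p" "F y z (jj x) p = F y (jj x) z p"
    "F z (jj x) y p = - F z x (jj y) p"
    using assms F_sym[of "jj y" z x] F_sym[of y z "jj x"] F_J[of z x y] by simp_all
  ultimately show "app2 g (Q x y) z p = (- app2 g (Q y x) z) p"
    using Q_F[OF assms, of p] Q_F[of y x z p] assms by simp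
qed

text \<open>In the symmetric part of \<open>Q(x,y,z)\<close> in \<open>y,z\<close> the first term of \<open>Q\<close> drops out, and what remains
  is a multiple of the cyclic sum for \<open>(Jx,y,z)\<close>.\<close>

lemma Q_skew_last:
  assumes "x \<in> fields" "y \<in> fields" "z \<in> fields"
  shows "app2 g (Q x y) z = - app2 g (Q x z) y"
proof
  fix p
  have "F (jj x) y z p + F y z (jj x) p + F z (jj x) y p = 0"
    using assms by (auto intro: cyclic_at)
  moreover have "F y z (jj x) p = F y (jj x) z p" "F (jj x) z y p = F (jj x) y z p"
    "F x (jj z) y p = F x y (jj z) p" "F x (jj y) z p = - F x y (jj z) p"
    using assms F_sym[of y z "jj x"] F_sym[of "jj x" z y] F_J[of x z y] F_J[of x y z]
      F_sym[of x "jj z" y]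
    by simp_all
  ultimately show "app2 g (Q x y) z p = (- app2 g (Q x z) y) p"
    using Q_F[OF assms, of p] Q_F[of x z y p] assms by simp
qed

sublocale skew_torsion_atlas A g D Q
proof
  fix x y z and f
  assume f: "x \<in> fields" "y \<in> fields"
  show "Q x y \<in> fields"
    using f by (simp add: Q_tensor_def)
  show "f \<in> smooth \<Longrightarrow> Q (fscale f x) y = fscale f (Q x y)"
    "f \<in> smooth \<Longrightarrow> Q x (fscale f y) = fscale f (Q x y)"
    using f by (simp_all add: Q_tensor_def J_fscale nJ_fscale vscale_fscale flip: fscale_diff)
  assume "z \<in> fields"
  then show "Q (x + y) z = Q x z + Q y z" "Q x (y + z) = Q x y + Q x z"
    using f by (simp_all add: Q_tensor_def J_add nJ_add vscale_add algebra_simps flip: vscale_add)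
  show "app2 g (Q x y) z = - app2 g (Q y x) z" "app2 g (Q x y) z = - app2 g (Q x z) y"
    using f \<open>z \<in> fields\<close> Q_skew_first Q_skew_last by blast+
qed

lemma nabla'_eq: "nabla' D J = conn'"
  by (simp add: nabla'_def conn'_def fun_eq_iff)

text \<open>This says \<open>g((\<nabla>'\<^sub>xJ)y,z) = 0\<close>. The left-hand side is half of
  \<open>F(x,y,z) + F(y,x,z) - F(Jx,Jy,z) - F(Jy,Jx,z)\<close>, which by the cyclic identities is
  \<open>(F(z,Jx,Jy) - F(z,x,y)) / 2 = 0\<close>.\<close>

lemma J_parallel:
  assumes "x \<in> fields" "y \<in> fields" "z \<in> fields"
  shows "app2 g (conn' x (jj y)) z = app2 g (conn' x y) (jj z)"
proof
  fix p
  have minus: "F u (- v) w p = - F u v w p" if "u \<in> fields" "v \<in> fields" "w \<in> fields" for u v w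
  proof -
    have "nJ u (- v) = - nJ u v"
      using that nJ_add(2)[of u v "- v"] nJ_add(2)[of u 0 0]
      by (simp add: eq_neg_iff_add_eq_0 add.commute)
    then show ?thesis using that by (simp add: tensor_F_def app2_minus_left)
  qed
  have Q1: "4 * app2 g (Q x (jj y)) z p = - F x y z p - F (jj x) (jj y) z p - 2 * F (jj y) (jj x) z p"
    using assms Q_F[of x "jj y" z p] by (simp add: J_J minus)
  have Q2: "4 * app2 g (Q x y) (jj z) p = F x y z p + F (jj x) (jj y) z p - 2 * F y x z p"
    using assms Q_F[of x y "jj z" p] by (simp add: F_J_J) (simp add: F_J)
  have nabla: "app2 g (D x (jj y)) z p = F x y z p + app2 g (D x y) (jj z) p"
    using assms by (simp add: tensor_F_def nabla_endo_def app2_diff_left metric_J)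
  have "F x y z p + F y z x p + F z x y p = 0"
    "F (jj x) (jj y) z p + F (jj y) z (jj x) p + F z (jj x) (jj y) p = 0"
    using assms by (auto intro: cyclic_at)
  moreover have "F z (jj x) (jj y) p = F z x y p" "F y z x p = F y x z p"
    "F (jj y) z (jj x) p = F (jj y) (jj x) z p"
    using assms F_sym[of y z x] F_sym[of "jj y" z "jj x"] by (simp_all add: F_J_J)
  ultimately show "app2 g (conn' x (jj y)) z p = app2 g (conn' x y) (jj z) p"
    using Q1 Q2 nabla assms by (simp add: conn'_def app2_add_left)
qed

lemma curvature04_conn'_J_J:
  assumes "x \<in> fields" "y \<in> fields" "z \<in> fields" "w \<in> fields"
  shows "curvature04 g conn' x y (jj z) (jj w) = - curvature04 g conn' x y z w"
proof -
  have "curvature04 g conn' x y (jj z) (jj w) = curvature04 g conn' x y z (jj (jj w))"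
    by (rule conn'.curvature04_symmetric_parallel) (use assms in \<open>simp_all add: metric_J J_parallel\<close>)
  then show ?thesis
    using assms by (simp add: J_J curvature04_def app2_minus_right)
qed

end

theorem theorem3p1:
  fixes A :: "('m::{t2_space,second_countable_topology}, 'e::euclidean_space) chart set"
    and J :: "'m endo_field" and g :: "'m bilin_field" and nabla :: "'m connection" and n :: nat
  assumes "DIM('e) = 2 * n"
    and "W3_manifold A J g nabla"
  shows "kaehler_tensor A J (curvature04 g (nabla' nabla J)) \<longleftrightarrow>
    (\<forall>x\<in>vector_fields A. \<forall>y\<in>vector_fields A. \<forall>z\<in>vector_fields A. \<forall>w\<in>vector_fields A. \<forall>p.
      3 * curvature04 g (nabla' nabla J) x y z w p =
        3 * curvature04 g nabla x y z w p
        + 2 * app2 g (Q_tensor nabla J x y) (Q_tensor nabla J z w) p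
        + app2 g (Q_tensor nabla J z y) (Q_tensor nabla J x w) p
        + app2 g (Q_tensor nabla J x z) (Q_tensor nabla J y w) p)"
proof -
  interpret W3_atlas A g nabla J
  proof
    show "smooth_manifold A" "almost_complex_norden A J g" "pseudo_riemannian_metric A g"
      "linear_connection A nabla"
      using assms(2) by (simp_all add: W3_manifold_def almost_complex_norden_def levi_civita_def)
    fix x y z
    assume f: "x \<in> vector_fields A" "y \<in> vector_fields A"
    have LC: "levi_civita A g nabla"
      using assms(2) by (simp add: W3_manifold_def)
    show "lie_bracket x y = nabla x y - nabla y x"
      using LC f unfolding levi_civita_def by metis
    assume "z \<in> vector_fields A"
    show "dir_deriv x (app2 g y z) = app2 g (nabla x y) z + app2 g y (nabla x z)"
      using LC f \<open>z \<in> vector_fields A\<close> unfolding levi_civita_def by blast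
    show "tensor_F g nabla J x y z + tensor_F g nabla J y z x + tensor_F g nabla J z x y = 0"
      using assms(2) f \<open>z \<in> vector_fields A\<close> unfolding W3_manifold_def by blast
  qed
  have "kaehler_tensor A J (curvature04 g conn') \<longleftrightarrow> curvature_like A (curvature04 g conn')"
    by (simp add: kaehler_tensor_def curvature04_conn'_J_J)
  then show ?thesis
    unfolding nabla'_eq by (simp add: curvature_like_conn'_iff)
qed

end
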